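(* For every $M\ge3$, the following hold for one-sided and two-sided heterogeneous circles with $M$ nodes having the same external rates $\{p_j\}$ and satisfying $$q_j^{\rm 1-sided}=q_{j-1,j}^{\rm 2-sided}+q_{j+1,j}^{\rm 2-sided},\qquad j=1,\dots,M. \qquad ( * )$$ There exists a pair of such circles for which $f^{\rm 1-sided}_{\rm circle}(t)>f^{\rm 2-sided}_{\rm circle}(t)$ for all $0<t<\infty$, and there exists a pair of such circles for which $f^{\rm 1-sided}_{\rm circle}(t)<f^{\rm 2-sided}_{\rm circle}(t)$ for all $0<t<\infty$.
   Context: Nodes $1,\dots,M$ have external rates $p_j\ge0$. $X_j(t)\in\{0,1\}$ is the state of node $j$ ($1$ = adopter), $X_j(0)=0$ for all $j$; adopters remain adopters forever, and $(X_1,\dots,X_M)$ is a continuous-time Markov chain in which one node changes at a time. On a one-sided circle each nonadopter $j$ becomes an adopter at rate $p_j+q_j^{\rm 1-sided}X_{j-1}(t)$. On a two-sided circle each nonadopter $j$ becomes an adopter at rate $p_j+q_{j-1,j}^{\rm 2-sided}X_{j-1}(t)+q_{j+1,j}^{\rm 2-sided}X_{j+1}(t)$. All rates $q$ are nonnegative, and node subscripts are taken modulo $M$ in $\{1,\dots,M\}$. In each case the expected fraction of adopters is $f(t)=\frac1M\,\mathbf{E}\big[\sum_{j=1}^M X_j(t)\big]$. *)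

theory Defs
  imports "HOL-Probability.Probability"
begin

text \<open>Nodes are \<open>1, \<dots>, M\<close>; the neighbours of a node are taken modulo \<open>M\<close> in this range.\<close>

definition pred_node :: "nat \<Rightarrow> nat \<Rightarrow> nat" where
  "pred_node M j = (if j = 1 then M else j - 1)"

definition succ_node :: "nat \<Rightarrow> nat \<Rightarrow> nat" where
  "succ_node M j = (if j = M then 1 else j + 1)"

text \<open>A configuration assigns 1 (adopter) or 0 (nonadopter) to every node.\<close>

definition configs :: "nat \<Rightarrow> (nat \<Rightarrow> real) set" where
  "configs M = ({1..M} \<rightarrow>\<^sub>E {0, 1})"

definition config_at :: "nat \<Rightarrow> (nat \<Rightarrow> real \<Rightarrow> 'w \<Rightarrow> real) \<Rightarrow> real \<Rightarrow> 'w \<Rightarrow> (nat \<Rightarrow> real)" where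
  "config_at M X t \<omega> = restrict (\<lambda>j. X j t \<omega>) {1..M}"

text \<open>
  The generator of the chain in which a nonadopter \<open>j\<close> adopts at rate \<open>r j x\<close> when the
  configuration is \<open>x\<close>. The only possible transitions turn one nonadopter into an adopter
  (off the diagonal, the sum has at most one term).
\<close>

definition generator :: "nat \<Rightarrow> (nat \<Rightarrow> (nat \<Rightarrow> real) \<Rightarrow> real) \<Rightarrow> (nat \<Rightarrow> real) \<Rightarrow> (nat \<Rightarrow> real) \<Rightarrow> real" where
  "generator M r x y =
     (if y = x then - (\<Sum>j | j \<in> {1..M} \<and> x j = 0. r j x)
      else (\<Sum>j | j \<in> {1..M} \<and> x j = 0 \<and> y = x(j := 1). r j x))"

text \<open>
  \<open>X j t\<close> is the state of node \<open>j\<close> at time \<open>t \<ge> 0\<close>. The last condition is the elementary Markov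
  property with stationary transition probabilities \<open>P h x y\<close>, where
  \<open>P h x y = of_bool (x = y) + h * generator M r x y + o(h)\<close> as \<open>h\<close> decreases to 0.
  As the transition probabilities do not depend on the current time, the generator
  and the initial configuration determine the law of the chain. That \<open>P\<close> is stochastic and satisfies
  the Chapman-Kolmogorov equations on the attained configurations follows from the Markov property.
\<close>

definition adoption_chain ::
  "nat \<Rightarrow> (nat \<Rightarrow> (nat \<Rightarrow> real) \<Rightarrow> real) \<Rightarrow> 'w measure \<Rightarrow> (nat \<Rightarrow> real \<Rightarrow> 'w \<Rightarrow> real) \<Rightarrow> bool" where
  "adoption_chain M r \<Omega> X \<longleftrightarrow>
     prob_space \<Omega> \<and>
     (\<forall>j\<in>{1..M}. \<forall>t\<ge>0. X j t \<in> borel_measurable \<Omega>) \<and>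
     (\<forall>j\<in>{1..M}. \<forall>t\<ge>0. \<forall>\<omega>\<in>space \<Omega>. X j t \<omega> \<in> {0, 1}) \<and>
     (\<forall>j\<in>{1..M}. \<forall>\<omega>\<in>space \<Omega>. X j 0 \<omega> = 0) \<and>
     (\<forall>j\<in>{1..M}. \<forall>\<omega>\<in>space \<Omega>. \<forall>s t. 0 \<le> s \<and> s \<le> t \<and> X j s \<omega> = 1 \<longrightarrow> X j t \<omega> = 1) \<and>
     (\<exists>P :: real \<Rightarrow> (nat \<Rightarrow> real) \<Rightarrow> (nat \<Rightarrow> real) \<Rightarrow> real.
        (\<forall>x\<in>configs M. \<forall>y\<in>configs M.
           ((\<lambda>h. (P h x y - of_bool (x = y)) / h) \<longlongrightarrow> generator M r x y) (at_right 0)) \<and>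
        (\<forall>(n::nat) (\<tau>::nat \<Rightarrow> real) \<xi> y h.
           0 \<le> \<tau> 0 \<and> (\<forall>i<n. \<tau> i < \<tau> (Suc i)) \<and> (\<forall>i\<le>n. \<xi> i \<in> configs M) \<and> y \<in> configs M \<and> 0 < h \<and>
           \<P>(\<omega> in \<Omega>. \<forall>i\<le>n. config_at M X (\<tau> i) \<omega> = \<xi> i) > 0 \<longrightarrow>
           \<P>(\<omega> in \<Omega>. config_at M X (\<tau> n + h) \<omega> = y \<bar> \<forall>i\<le>n. config_at M X (\<tau> i) \<omega> = \<xi> i)
             = P h (\<xi> n) y))"

text \<open>On the one-sided circle, \<open>q j\<close> is the influence of node \<open>j - 1\<close> on node \<open>j\<close>.\<close>

definition one_sided_circle ::
  "nat \<Rightarrow> (nat \<Rightarrow> real) \<Rightarrow> (nat \<Rightarrow> real) \<Rightarrow> 'w measure \<Rightarrow> (nat \<Rightarrow> real \<Rightarrow> 'w \<Rightarrow> real) \<Rightarrow> bool" where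
  "one_sided_circle M p q \<Omega> X \<longleftrightarrow>
     (\<forall>j\<in>{1..M}. p j \<ge> 0 \<and> q j \<ge> 0) \<and>
     adoption_chain M (\<lambda>j x. p j + q j * x (pred_node M j)) \<Omega> X"

text \<open>On the two-sided circle, \<open>q i j\<close> is the influence of node \<open>i\<close> on its neighbour \<open>j\<close>.\<close>

definition two_sided_circle ::
  "nat \<Rightarrow> (nat \<Rightarrow> real) \<Rightarrow> (nat \<Rightarrow> nat \<Rightarrow> real) \<Rightarrow> 'w measure \<Rightarrow> (nat \<Rightarrow> real \<Rightarrow> 'w \<Rightarrow> real) \<Rightarrow> bool" where
  "two_sided_circle M p q \<Omega> X \<longleftrightarrow>
     (\<forall>j\<in>{1..M}. p j \<ge> 0 \<and> q (pred_node M j) j \<ge> 0 \<and> q (succ_node M j) j \<ge> 0) \<and>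
     adoption_chain M
       (\<lambda>j x. p j + q (pred_node M j) j * x (pred_node M j) + q (succ_node M j) j * x (succ_node M j)) \<Omega> X"

definition adopter_fraction :: "nat \<Rightarrow> 'w measure \<Rightarrow> (nat \<Rightarrow> real \<Rightarrow> 'w \<Rightarrow> real) \<Rightarrow> real \<Rightarrow> real" where
  "adopter_fraction M \<Omega> X t = (1 / real M) * prob_space.expectation \<Omega> (\<lambda>\<omega>. \<Sum>j=1..M. X j t \<omega>)"

text \<open>
  A pair of circles with the same external rates and matching internal rates, each realised on its
  own probability space. The sample space of real sequences, with an arbitrary sigma-algebra, is rich
  enough to carry any finite adoption chain; fixing it allows circles to be quantified
  existentially.
\<close>

definition matched_circles ::
  "nat \<Rightarrow> (nat \<Rightarrow> real) \<Rightarrow> (nat \<Rightarrow> real) \<Rightarrow> (nat \<Rightarrow> nat \<Rightarrow> real) \<Rightarrow>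
   (nat \<Rightarrow> real) measure \<Rightarrow> (nat \<Rightarrow> real \<Rightarrow> (nat \<Rightarrow> real) \<Rightarrow> real) \<Rightarrow>
   (nat \<Rightarrow> real) measure \<Rightarrow> (nat \<Rightarrow> real \<Rightarrow> (nat \<Rightarrow> real) \<Rightarrow> real) \<Rightarrow> bool" where
  "matched_circles M p q1 q2 \<Omega>1 X1 \<Omega>2 X2 \<longleftrightarrow>
     one_sided_circle M p q1 \<Omega>1 X1 \<and> two_sided_circle M p q2 \<Omega>2 X2 \<and>
     (\<forall>j\<in>{1..M}. q1 j = q2 (pred_node M j) j + q2 (succ_node M j) j)"

end

theory Submission
  imports Defs "HOL-Real_Asymp.Real_Asymp"
begin

text \<open>
  Let a single node have a positive external rate, and let the internal rates vanish except for those
  into one of its neighbours. The influence on that neighbour comes from the first node in one circle of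
  the pair, so that two nodes eventually adopt; in the other circle it comes from the opposite side,
  where nobody ever adopts, so that only the first node does. Placing the neighbour after or before the first
  node on the circle decides which of the two circles is ahead. Both chains are built from the same pair of
  exponential clocks, hence the comparison is pointwise.
\<close>

text \<open>Since only existence is claimed, the rates are free. External rate 2 and internal rate 1
  are the rates of the successive spacings of two independent unit exponentials, so both adoption
  times are read off the sorted clocks and every probability becomes a sum of products of
  one-dimensional ones. For general rates the second adoption time would be a sum of independent
  exponentials, which calls for convolution integrals. The main obstacle is the definition of a
  chain: it prescribes the conditional law given the configurations at any finite number of earlier
  times, so each attainable past has to be rewritten as an event about the clocks. This is feasible
  because the adopter set grows through at most three states. The matching condition survives
  because the internal rate 1 is moved as a whole from one side of the neighbour to the other. The
  resulting gap between the fractions is the probability that the second adoption has occurred,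
  divided by \<open>M\<close>.\<close>

section \<open>Configurations as adopter sets, and their generators\<close>

definition config_of :: "nat \<Rightarrow> nat set \<Rightarrow> nat \<Rightarrow> real" where
  "config_of M S = (\<lambda>j\<in>{1..M}. of_bool (j \<in> S))"

text \<open>Together with \<open>config_of\<close>, this is a bijection between the subsets of
  \<open>{1..M}\<close> and \<open>configs M\<close>. The restriction in \<open>config_of\<close>
  supplies the value \<open>undefined\<close> outside \<open>{1..M}\<close> that extensional
  functions require. On the side of sets, an adoption is an insertion.\<close>

definition adopters :: "nat \<Rightarrow> (nat \<Rightarrow> real) \<Rightarrow> nat set" where
  "adopters M x = {j\<in>{1..M}. x j = 1}"

lemma config_of_apply [simp]: "j \<in> {1..M} \<Longrightarrow> config_of M S j = of_bool (j \<in> S)"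
  by (simp add: config_of_def)

lemma adopters_config_of: "S \<subseteq> {1..M} \<Longrightarrow> adopters M (config_of M S) = S"
  by (auto simp: adopters_def config_of_def)

lemma config_of_adopters: "x \<in> configs M \<Longrightarrow> config_of M (adopters M x) = x"
  by (fastforce simp: adopters_def config_of_def configs_def fun_eq_iff PiE_iff extensional_def)

lemma adopters_subset: "adopters M x \<subseteq> {1..M}"
  by (auto simp: adopters_def)

lemma config_of_eq_iff:
  "S \<subseteq> {1..M} \<Longrightarrow> T \<subseteq> {1..M} \<Longrightarrow> config_of M S = config_of M T \<longleftrightarrow> S = T"
  by (metis adopters_config_of)

lemma config_of_update: "k \<in> {1..M} \<Longrightarrow> (config_of M S)(k := 1) = config_of M (insert k S)"
  by (auto simp: config_of_def fun_eq_iff)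

text \<open>Only \<open>k\<close> can adopt, so both sums in \<open>generator\<close> collapse to
  the term for \<open>k\<close>; off the diagonal that term survives only if \<open>T\<close> is the
  result of this adoption. The two indicators never hold together because \<open>k\<close> lies
  outside \<open>S\<close>.\<close>

lemma generator_config_of:
  assumes S: "S \<subseteq> {1..M}" and T: "T \<subseteq> {1..M}" and k: "k \<in> {1..M} - S"
    and r0: "\<And>j. j \<in> {1..M} - S \<Longrightarrow> j \<noteq> k \<Longrightarrow> r j (config_of M S) = 0"
  shows "generator M r (config_of M S) (config_of M T) =
    r k (config_of M S) * (of_bool (T = insert k S) - of_bool (T = S))"
proof -
  have nonadopter: "config_of M S j = 0 \<longleftrightarrow> j \<notin> S" if "j \<in> {1..M}" for j
    using that by simp
  show ?thesis
  proof (cases "T = S")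
    case True
    have "(\<Sum>j | j \<in> {1..M} \<and> config_of M S j = 0. r j (config_of M S))
        = (\<Sum>j\<in>{k}. r j (config_of M S))"
    proof (rule sum.mono_neutral_right)
      show "\<forall>j\<in>{j. j \<in> {1..M} \<and> config_of M S j = 0} - {k}. r j (config_of M S) = 0"
        using r0 nonadopter by blast
    qed (use k in auto)
    then show ?thesis
      using True k by (auto simp: generator_def)
  next
    case False
    have eq: "config_of M T = (config_of M S)(j := 1) \<longleftrightarrow> T = insert j S" if "j \<in> {1..M}" for j
      using that S T by (simp add: config_of_update config_of_eq_iff)
    have "(\<Sum>j | j \<in> {1..M} \<and> config_of M S j = 0 \<and> config_of M T = (config_of M S)(j := 1).
            r j (config_of M S))
        = (\<Sum>j\<in>{j. j = k \<and> T = insert k S}. r j (config_of M S))"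
    proof (rule sum.mono_neutral_right)
      show "{j. j = k \<and> T = insert k S} \<subseteq> {j. j \<in> {1..M} \<and> config_of M S j = 0
          \<and> config_of M T = (config_of M S)(j := 1)}"
        using k nonadopter eq by blast
      show "\<forall>j\<in>{j. j \<in> {1..M} \<and> config_of M S j = 0 \<and> config_of M T = (config_of M S)(j := 1)}
          - {j. j = k \<and> T = insert k S}. r j (config_of M S) = 0"
        using r0 nonadopter eq by blast
    qed simp
    then show ?thesis
      using False S T by (simp add: generator_def config_of_eq_iff)
  qed
qed

lemma generator_config_of_absorbing:
  assumes "S \<subseteq> {1..M}" "T \<subseteq> {1..M}"
    and "\<And>j. j \<in> {1..M} - S \<Longrightarrow> r j (config_of M S) = 0"
  shows "generator M r (config_of M S) (config_of M T) = 0"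
proof -
  have "r j (config_of M S) = 0" if "j \<in> {1..M}" "config_of M S j = 0" for j
    using that assms(3)[of j] by (cases "j \<in> S") auto
  then show ?thesis
    unfolding generator_def by (auto intro!: sum.neutral)
qed

section \<open>A criterion for set-valued processes to be adoption chains\<close>

text \<open>Here \<open>R\<close> contains all reachable adopter sets and \<open>K\<close> is the
  transition function on them. In \<open>step\<close> the Markov property is multiplied out into
  joint probabilities, so no conditioning remains. It is requested only for pasts attained by some
  sample point \<open>\<omega>0\<close>, from which the shape of the prescribed past can then be
  deduced.\<close>

lemma adoption_chainI:
  fixes A :: "real \<Rightarrow> 'w \<Rightarrow> nat set" and K :: "real \<Rightarrow> nat set \<Rightarrow> nat set \<Rightarrow> real"
  assumes "prob_space \<Omega>"
    and meas: "\<And>j t. 0 \<le> t \<Longrightarrow> {\<omega>\<in>space \<Omega>. j \<in> A t \<omega>} \<in> sets \<Omega>"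
    and init: "\<And>\<omega>. \<omega> \<in> space \<Omega> \<Longrightarrow> A 0 \<omega> = {}"
    and mono: "\<And>s t \<omega>. 0 \<le> s \<Longrightarrow> s \<le> t \<Longrightarrow> \<omega> \<in> space \<Omega> \<Longrightarrow> A s \<omega> \<subseteq> A t \<omega>"
    and reach: "\<And>t \<omega>. 0 \<le> t \<Longrightarrow> \<omega> \<in> space \<Omega> \<Longrightarrow> A t \<omega> \<in> R"
    and R: "\<And>S. S \<in> R \<Longrightarrow> S \<subseteq> {1..M}"
    and rate: "\<And>S T. S \<in> R \<Longrightarrow> T \<subseteq> {1..M} \<Longrightarrow>
      ((\<lambda>h. (K h S T - of_bool (S = T)) / h) \<longlongrightarrow> generator M r (config_of M S) (config_of M T)) (at_right 0)"
    and zero: "\<And>h S T. S \<in> R \<Longrightarrow> T \<notin> R \<Longrightarrow> K h S T = 0"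
    and step: "\<And>(n::nat) \<tau> \<xi> T h \<omega>0. (\<And>i. i \<le> n \<Longrightarrow> 0 \<le> \<tau> i \<and> \<tau> i \<le> \<tau> n) \<Longrightarrow> T \<in> R \<Longrightarrow> 0 < h \<Longrightarrow>
      \<omega>0 \<in> space \<Omega> \<Longrightarrow> (\<And>i. i \<le> n \<Longrightarrow> A (\<tau> i) \<omega>0 = \<xi> i) \<Longrightarrow>
      \<P>(\<omega> in \<Omega>. A (\<tau> n + h) \<omega> = T \<and> (\<forall>i\<le>n. A (\<tau> i) \<omega> = \<xi> i)) =
      \<P>(\<omega> in \<Omega>. \<forall>i\<le>n. A (\<tau> i) \<omega> = \<xi> i) * K h (\<xi> n) T"
  shows "adoption_chain M r \<Omega> (\<lambda>j t \<omega>. of_bool (j \<in> A t \<omega>))"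
proof -
  interpret prob_space \<Omega> by fact
  define X where "X = (\<lambda>j t \<omega>. of_bool (j \<in> A t \<omega>) :: real)"
  \<comment> \<open>The Markov property says nothing about unattained configurations, but the rate condition does:
    there the transition probabilities are replaced by their first-order expansion.\<close>
  define P where "P h x y = (if x \<in> config_of M ` R then K h (adopters M x) (adopters M y)
      else of_bool (x = y) + h * generator M r x y)" for h x y
  have config_at: "config_at M X t \<omega> = config_of M (A t \<omega>)" for t \<omega>
    by (simp add: config_at_def config_of_def X_def restrict_def)
  have X_meas: "X j t \<in> borel_measurable \<Omega>" if "0 \<le> t" for j t
  proof -
    have "indicator {\<omega>\<in>space \<Omega>. j \<in> A t \<omega>} \<in> borel_measurable \<Omega>"
      using meas[OF that] by (rule borel_measurable_indicator)
    then show ?thesis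
      by (rule measurable_cong[THEN iffD1, rotated]) (simp add: X_def indicator_def)
  qed
  have X_mono: "X j t \<omega> = 1" if "0 \<le> s" "s \<le> t" "\<omega> \<in> space \<Omega>" "X j s \<omega> = 1" for j s t \<omega>
    using mono[OF that(1-3)] that(4) by (auto simp: X_def)
  have P_rate: "((\<lambda>h. (P h x y - of_bool (x = y)) / h) \<longlongrightarrow> generator M r x y) (at_right 0)"
    if x: "x \<in> configs M" and y: "y \<in> configs M" for x y
  proof (cases "x \<in> config_of M ` R")
    case True
    then obtain S where S: "S \<in> R" "x = config_of M S" by auto
    have eq: "x = y \<longleftrightarrow> S = adopters M y"
      using S R y by (metis adopters_config_of config_of_adopters)
    have "P h x y = K h S (adopters M y)" for h
      using True by (simp add: P_def S adopters_config_of[OF R])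
    then show ?thesis
      using rate[OF S(1) adopters_subset[of M y]]
      by (simp only: eq config_of_adopters[OF y] S(2)[symmetric])
  next
    case False
    have "\<forall>\<^sub>F h in at_right (0::real). generator M r x y = (P h x y - of_bool (x = y)) / h"
      using eventually_at_right_less[of "0::real"] by eventually_elim (use False in \<open>simp add: P_def\<close>)
    then show ?thesis
      by (rule Lim_transform_eventually[OF tendsto_const])
  qed
  have P_step: "\<P>(\<omega> in \<Omega>. config_at M X (\<tau> n + h) \<omega> = y \<bar> \<forall>i\<le>n. config_at M X (\<tau> i) \<omega> = \<xi> i)
      = P h (\<xi> n) y"
    if \<tau>0: "0 \<le> \<tau> 0" and \<tau>: "\<forall>i<n. \<tau> i < \<tau> (Suc i)" and \<xi>: "\<forall>i\<le>n. \<xi> i \<in> configs M"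
      and y: "y \<in> configs M" and h: "0 < h"
      and pos: "\<P>(\<omega> in \<Omega>. \<forall>i\<le>n. config_at M X (\<tau> i) \<omega> = \<xi> i) > 0" for n \<tau> \<xi> y h
  proof -
    have \<tau>_le: "\<tau> i \<le> \<tau> j" if "i \<le> j" "j \<le> n" for i j
      using that
    proof (induction j rule: dec_induct)
      case (step j)
      then have "\<tau> i \<le> \<tau> j" "\<tau> j < \<tau> (Suc j)" using \<tau> by auto
      then show ?case by simp
    qed simp
    have \<tau>_nn: "0 \<le> \<tau> i" if "i \<le> n" for i
      using \<tau>_le[of 0 i] that \<tau>0 by simp
    have iff: "config_at M X t \<omega> = x \<longleftrightarrow> A t \<omega> = adopters M x"
      if "0 \<le> t" "\<omega> \<in> space \<Omega>" "x \<in> configs M" for t \<omega> x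
      using that R[OF reach[OF that(1,2)]]
      by (metis adopters_config_of config_at config_of_adopters)
    have iff_past: "(\<forall>i\<le>n. config_at M X (\<tau> i) \<omega> = \<xi> i) \<longleftrightarrow> (\<forall>i\<le>n. A (\<tau> i) \<omega> = adopters M (\<xi> i))"
      if "\<omega> \<in> space \<Omega>" for \<omega>
      using iff[OF \<tau>_nn that] \<xi> by simp
    have iff_future: "config_at M X (\<tau> n + h) \<omega> = y \<longleftrightarrow> A (\<tau> n + h) \<omega> = adopters M y"
      if "\<omega> \<in> space \<Omega>" for \<omega>
      using iff[OF _ that y] \<tau>_nn[of n] h by simp
    have past: "{\<omega>\<in>space \<Omega>. \<forall>i\<le>n. config_at M X (\<tau> i) \<omega> = \<xi> i} =
        {\<omega>\<in>space \<Omega>. \<forall>i\<le>n. A (\<tau> i) \<omega> = adopters M (\<xi> i)}"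
      using iff_past by blast
    have past_and_future: "{\<omega>\<in>space \<Omega>. config_at M X (\<tau> n + h) \<omega> = y \<and> (\<forall>i\<le>n. config_at M X (\<tau> i) \<omega> = \<xi> i)} =
        {\<omega>\<in>space \<Omega>. A (\<tau> n + h) \<omega> = adopters M y \<and> (\<forall>i\<le>n. A (\<tau> i) \<omega> = adopters M (\<xi> i))}"
      using iff_past iff_future by blast
    \<comment> \<open>The conditioning event has positive probability, hence is nonempty; any of its
      points witnesses that the past is attainable.\<close>
    obtain \<omega>0 where \<omega>0: "\<omega>0 \<in> space \<Omega>" "\<forall>i\<le>n. A (\<tau> i) \<omega>0 = adopters M (\<xi> i)"
    proof -
      have "{\<omega>\<in>space \<Omega>. \<forall>i\<le>n. A (\<tau> i) \<omega> = adopters M (\<xi> i)} \<noteq> {}"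
        using pos past by (metis less_irrefl measure_empty)
      then show ?thesis using that by auto
    qed
    have \<xi>n: "adopters M (\<xi> n) \<in> R"
      using \<omega>0 reach[OF \<tau>_nn[of n] \<omega>0(1)] by auto
    then have P: "P h (\<xi> n) y = K h (adopters M (\<xi> n)) (adopters M y)"
      using \<xi> config_of_adopters[of "\<xi> n" M] by (force simp: P_def)
    show ?thesis
    proof (cases "adopters M y \<in> R")
      case True
      show ?thesis
        using step[OF _ True h \<omega>0(1), of n \<tau> "\<lambda>i. adopters M (\<xi> i)"] \<omega>0(2) \<tau>_nn \<tau>_le pos
        by (simp add: cond_prob_def past past_and_future P)
    next
      case False
      have "{\<omega>\<in>space \<Omega>. A (\<tau> n + h) \<omega> = adopters M y \<and> (\<forall>i\<le>n. A (\<tau> i) \<omega> = adopters M (\<xi> i))} = {}"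
        using False reach[of "\<tau> n + h"] \<tau>_nn[of n] h by force
      then show ?thesis
        by (simp only: cond_prob_def past_and_future P zero[OF \<xi>n False] measure_empty div_0)
    qed
  qed
  have "adoption_chain M r \<Omega> X"
    unfolding adoption_chain_def
  proof (intro conjI exI[of _ P])
    show "\<forall>x\<in>configs M. \<forall>y\<in>configs M.
        ((\<lambda>h. (P h x y - of_bool (x = y)) / h) \<longlongrightarrow> generator M r x y) (at_right 0)"
      using P_rate by blast
  qed (use P_step prob_space_axioms X_meas X_mono init in \<open>auto simp: X_def\<close>)
  then show ?thesis by (simp add: X_def)
qed

section \<open>The order statistics of two exponential clocks\<close>

text \<open>
  The minimum of two independent unit exponential clocks is exponential with rate 2, and the
  maximum follows it after an independent unit exponential delay. Hence the order statistics of the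
  clocks realise a chain of two successive adoptions with rates 2 and 1, and each event that describes
  the past is a disjoint union of two boxes.
\<close>

locale two_clocks = prob_space \<Omega> for \<Omega> :: "'w measure" +
  fixes U V :: "'w \<Rightarrow> real"
  assumes U_meas [measurable]: "U \<in> borel_measurable \<Omega>"
    and V_meas [measurable]: "V \<in> borel_measurable \<Omega>"
    and U_pos: "\<And>\<omega>. 0 < U \<omega>" and V_pos: "\<And>\<omega>. 0 < V \<omega>"
    and box: "\<And>I J. I \<in> sets borel \<Longrightarrow> J \<in> sets borel \<Longrightarrow>
      \<P>(\<omega> in \<Omega>. U \<omega> \<in> I \<and> V \<omega> \<in> J) = \<P>(\<omega> in \<Omega>. U \<omega> \<in> I) * \<P>(\<omega> in \<Omega>. V \<omega> \<in> J)"
    and U_tail: "\<And>t. 0 \<le> t \<Longrightarrow> \<P>(\<omega> in \<Omega>. U \<omega> \<in> {t<..}) = exp (- t)"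
    and V_tail: "\<And>t. 0 \<le> t \<Longrightarrow> \<P>(\<omega> in \<Omega>. V \<omega> \<in> {t<..}) = exp (- t)"
begin

definition first :: "'w \<Rightarrow> real" where "first \<omega> = min (U \<omega>) (V \<omega>)"
definition second :: "'w \<Rightarrow> real" where "second \<omega> = max (U \<omega>) (V \<omega>)"

lemma first_meas [measurable]: "first \<in> borel_measurable \<Omega>"
  unfolding first_def[abs_def] by measurable

lemma second_meas [measurable]: "second \<in> borel_measurable \<Omega>"
  unfolding second_def[abs_def] by measurable

lemma first_pos: "0 < first \<omega>"
  by (simp add: first_def U_pos V_pos)

lemma first_le_second: "first \<omega> \<le> second \<omega>"
  unfolding first_def second_def by linarith

lemma prob_first_tail: "0 \<le> t \<Longrightarrow> \<P>(\<omega> in \<Omega>. t < first \<omega>) = exp (- 2 * t)"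
  using box[of "{t<..}" "{t<..}"]
  by (simp add: U_tail[simplified] V_tail[simplified] first_def flip: exp_add)

text \<open>As \<open>I\<close> lies in \<open>{..t}\<close>, one clock falls into \<open>I\<close>
  and the other beyond \<open>t\<close>; the two choices give disjoint boxes. The dependence on
  \<open>t\<close> is the bare factor \<open>exp (- t)\<close> for every Borel set \<open>I\<close>:
  whatever is known about the first adoption, the remaining clock is memoryless.\<close>

lemma prob_first_second:
  assumes t: "0 \<le> t" and I: "I \<in> sets borel" "I \<subseteq> {..t}"
  shows "\<P>(\<omega> in \<Omega>. first \<omega> \<in> I \<and> t < second \<omega>)
    = (\<P>(\<omega> in \<Omega>. U \<omega> \<in> I) + \<P>(\<omega> in \<Omega>. V \<omega> \<in> I)) * exp (- t)"
proof -
  have [measurable]: "I \<in> sets borel" by fact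
  have "{\<omega>\<in>space \<Omega>. first \<omega> \<in> I \<and> t < second \<omega>} =
      {\<omega>\<in>space \<Omega>. U \<omega> \<in> I \<and> V \<omega> \<in> {t<..}} \<union> {\<omega>\<in>space \<Omega>. U \<omega> \<in> {t<..} \<and> V \<omega> \<in> I}"
    using I by (auto simp: first_def second_def min_def max_def split: if_splits)
  also have "prob \<dots> = prob {\<omega>\<in>space \<Omega>. U \<omega> \<in> I \<and> V \<omega> \<in> {t<..}}
      + prob {\<omega>\<in>space \<Omega>. U \<omega> \<in> {t<..} \<and> V \<omega> \<in> I}"
    by (rule finite_measure_Union) (use I in auto)
  also have "\<dots> = \<P>(\<omega> in \<Omega>. U \<omega> \<in> I) * exp (- t) + exp (- t) * \<P>(\<omega> in \<Omega>. V \<omega> \<in> I)"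
    using box[OF I(1), of "{t<..}"] box[OF _ I(1), of "{t<..}"] U_tail[OF t] V_tail[OF t] by simp
  finally show ?thesis by (simp add: algebra_simps)
qed

lemma prob_clock_Ioc:
  assumes "0 \<le> s" "s \<le> t"
  shows "\<P>(\<omega> in \<Omega>. U \<omega> \<in> {s<..t}) = exp (- s) - exp (- t)"
    and "\<P>(\<omega> in \<Omega>. V \<omega> \<in> {s<..t}) = exp (- s) - exp (- t)"
proof -
  have "prob ({\<omega>\<in>space \<Omega>. U \<omega> \<in> {s<..}} - {\<omega>\<in>space \<Omega>. U \<omega> \<in> {t<..}}) = exp (- s) - exp (- t)"
    by (subst finite_measure_Diff) (use assms U_tail[of s] U_tail[of t] in auto)
  also have "{\<omega>\<in>space \<Omega>. U \<omega> \<in> {s<..}} - {\<omega>\<in>space \<Omega>. U \<omega> \<in> {t<..}} = {\<omega>\<in>space \<Omega>. U \<omega> \<in> {s<..t}}"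
    by auto
  finally show "\<P>(\<omega> in \<Omega>. U \<omega> \<in> {s<..t}) = exp (- s) - exp (- t)" .
  have "prob ({\<omega>\<in>space \<Omega>. V \<omega> \<in> {s<..}} - {\<omega>\<in>space \<Omega>. V \<omega> \<in> {t<..}}) = exp (- s) - exp (- t)"
    by (subst finite_measure_Diff) (use assms V_tail[of s] V_tail[of t] in auto)
  also have "{\<omega>\<in>space \<Omega>. V \<omega> \<in> {s<..}} - {\<omega>\<in>space \<Omega>. V \<omega> \<in> {t<..}} = {\<omega>\<in>space \<Omega>. V \<omega> \<in> {s<..t}}"
    by auto
  finally show "\<P>(\<omega> in \<Omega>. V \<omega> \<in> {s<..t}) = exp (- s) - exp (- t)" .
qed

lemma prob_both_Ioc:
  assumes "0 \<le> s" "s \<le> t"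
  shows "\<P>(\<omega> in \<Omega>. s < first \<omega> \<and> second \<omega> \<le> t) = (exp (- s) - exp (- t))\<^sup>2"
proof -
  have "{\<omega>\<in>space \<Omega>. s < first \<omega> \<and> second \<omega> \<le> t} = {\<omega>\<in>space \<Omega>. U \<omega> \<in> {s<..t} \<and> V \<omega> \<in> {s<..t}}"
    by (auto simp: first_def second_def)
  then show ?thesis
    using box[of "{s<..t}" "{s<..t}"] prob_clock_Ioc[OF assms] by (simp add: power2_eq_square)
qed

lemma prob_first_Ioc:
  assumes "0 \<le> s" "s \<le> t"
  shows "\<P>(\<omega> in \<Omega>. s < first \<omega> \<and> first \<omega> \<le> t) = exp (- 2 * s) - exp (- 2 * t)"
proof -
  have "{\<omega>\<in>space \<Omega>. s < first \<omega> \<and> first \<omega> \<le> t} =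
      {\<omega>\<in>space \<Omega>. s < first \<omega>} - {\<omega>\<in>space \<Omega>. t < first \<omega>}"
    by auto
  also have "prob \<dots> = exp (- 2 * s) - exp (- 2 * t)"
    by (subst finite_measure_Diff) (use assms prob_first_tail[of s] prob_first_tail[of t] in auto)
  finally show ?thesis .
qed

lemma prob_first_second_Ioc:
  assumes "0 \<le> s" "s \<le> t" and I: "I \<in> sets borel" "I \<subseteq> {..s}"
  shows "\<P>(\<omega> in \<Omega>. first \<omega> \<in> I \<and> s < second \<omega> \<and> second \<omega> \<le> t)
    = (\<P>(\<omega> in \<Omega>. U \<omega> \<in> I) + \<P>(\<omega> in \<Omega>. V \<omega> \<in> I)) * (exp (- s) - exp (- t))"
proof -
  have [measurable]: "I \<in> sets borel" by fact
  \<comment> \<open>The events \<open>E r\<close> decrease in \<open>r\<close>, and \<open>I\<close>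
    lies below both \<open>s\<close> and \<open>t\<close>, so the event in question is a difference
    of two to which the previous formula applies with the same \<open>I\<close>.\<close>
  define E where "E r = {\<omega>\<in>space \<Omega>. first \<omega> \<in> I \<and> r < second \<omega>}" for r
  have E_sets: "E r \<in> sets \<Omega>" for r
    unfolding E_def by measurable
  have E_prob: "prob (E r) = (\<P>(\<omega> in \<Omega>. U \<omega> \<in> I) + \<P>(\<omega> in \<Omega>. V \<omega> \<in> I)) * exp (- r)"
    if "s \<le> r" for r
    unfolding E_def using that assms by (intro prob_first_second) auto
  have "{\<omega>\<in>space \<Omega>. first \<omega> \<in> I \<and> s < second \<omega> \<and> second \<omega> \<le> t} = E s - E t"
    by (auto simp: E_def)
  moreover have "prob (E s - E t) = prob (E s) - prob (E t)"
    using assms(2) by (intro finite_measure_Diff E_sets) (auto simp: E_def)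
  ultimately show ?thesis
    using E_prob[OF order_refl] E_prob[OF assms(2)] by (simp only: right_diff_distrib)
qed

section \<open>The chains with one and with two adopting nodes\<close>

text \<open>The waiting time for \<open>a\<close> is \<open>first\<close>, whose rate is 2; all
  other rates vanish at both reachable sets, so \<open>{a}\<close> is absorbing.\<close>

lemma single_adoption_chain:
  assumes a: "a \<in> {1..M}" and ra: "r a (config_of M {}) = 2"
    and r0: "\<And>j S. j \<in> {1..M} - {a} \<Longrightarrow> S \<subseteq> {a} \<Longrightarrow> r j (config_of M S) = 0"
  shows "adoption_chain M r \<Omega> (\<lambda>j t \<omega>. of_bool (j = a \<and> first \<omega> \<le> t))"
proof -
  define A where "A t \<omega> = (if t < first \<omega> then {} else {a})" for t \<omega>
  define K :: "real \<Rightarrow> nat set \<Rightarrow> nat set \<Rightarrow> real" where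
    "K h S T = (if S = {} then if T = {} then exp (- 2 * h)
        else if T = {a} then 1 - exp (- 2 * h) else 0 else of_bool (T = S))" for h S T
  have mem: "j \<in> A t \<omega> \<longleftrightarrow> j = a \<and> first \<omega> \<le> t" for j t \<omega>
    by (auto simp: A_def)
  have "adoption_chain M r \<Omega> (\<lambda>j t \<omega>. of_bool (j \<in> A t \<omega>))"
  proof (rule adoption_chainI[where R = "{{}, {a}}" and K = K])
    show "{\<omega>\<in>space \<Omega>. j \<in> A t \<omega>} \<in> sets \<Omega>" for j t
      unfolding mem by measurable
    show "((\<lambda>h. (K h S T - of_bool (S = T)) / h) \<longlongrightarrow>
        generator M r (config_of M S) (config_of M T)) (at_right 0)"
      if S: "S \<in> {{}, {a}}" and T: "T \<subseteq> {1..M}" for S T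
    proof (cases "S = {}")
      case True
      have g: "generator M r (config_of M {}) (config_of M T) = 2 * (of_bool (T = {a}) - of_bool (T = {}))"
        using generator_config_of[OF _ T, of "{}" a r] a r0 ra by simp
      have 1: "((\<lambda>h::real. (exp (- 2 * h) - 1) / h) \<longlongrightarrow> - 2) (at_right 0)"
        and 2: "((\<lambda>h::real. (1 - exp (- 2 * h)) / h) \<longlongrightarrow> 2) (at_right 0)"
        by real_asymp+
      consider "T = {}" | "T = {a}" | "T \<noteq> {}" "T \<noteq> {a}" by blast
      then show ?thesis
        unfolding True g by cases (use 1 2 in \<open>auto simp: K_def\<close>)
    next
      case False
      then have "S = {a}" using S by simp
      moreover have "generator M r (config_of M {a}) (config_of M T) = 0"
        by (rule generator_config_of_absorbing) (use a T r0 in auto)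
      ultimately show ?thesis by (auto simp: K_def)
    qed
    show "\<P>(\<omega> in \<Omega>. A (\<tau> n + h) \<omega> = T \<and> (\<forall>i\<le>n. A (\<tau> i) \<omega> = \<xi> i)) =
        \<P>(\<omega> in \<Omega>. \<forall>i\<le>n. A (\<tau> i) \<omega> = \<xi> i) * K h (\<xi> n) T"
      if \<tau>: "\<And>i. i \<le> n \<Longrightarrow> 0 \<le> \<tau> i \<and> \<tau> i \<le> \<tau> n" and T: "T \<in> {{}, {a}}" and h: "0 < h"
        and \<omega>0: "\<omega>0 \<in> space \<Omega>" "\<And>i. i \<le> n \<Longrightarrow> A (\<tau> i) \<omega>0 = \<xi> i" for n :: nat and \<tau> \<xi> T h \<omega>0
    proof (cases "\<xi> n = {}")
      case True
      \<comment> \<open>Adopter sets grow, so along \<open>\<omega>0\<close> an empty set at the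
        last time forces empty sets before. The whole past thus amounts to
        \<open>\<tau> n < first \<omega>\<close>.\<close>
      have \<xi>: "\<xi> i = {}" if "i \<le> n" for i
        using \<omega>0(2)[OF that] \<omega>0(2)[of n] True \<tau>[OF that] by (auto simp: A_def split: if_splits)
      have past: "(\<forall>i\<le>n. A (\<tau> i) \<omega> = \<xi> i) \<longleftrightarrow> \<tau> n < first \<omega>" for \<omega>
        using \<xi> \<tau> by (force simp: A_def split: if_splits)
      have \<tau>n: "0 \<le> \<tau> n" using \<tau> by simp
      have none: "\<P>(\<omega> in \<Omega>. A (\<tau> n + h) \<omega> = {} \<and> \<tau> n < first \<omega>) = exp (- 2 * (\<tau> n + h))"
      proof -
        have "{\<omega>\<in>space \<Omega>. A (\<tau> n + h) \<omega> = {} \<and> \<tau> n < first \<omega>} = {\<omega>\<in>space \<Omega>. \<tau> n + h < first \<omega>}"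
          using h by (auto simp: A_def)
        then show ?thesis using prob_first_tail[of "\<tau> n + h"] \<tau>n h by simp
      qed
      have one: "\<P>(\<omega> in \<Omega>. A (\<tau> n + h) \<omega> = {a} \<and> \<tau> n < first \<omega>)
          = exp (- 2 * \<tau> n) - exp (- 2 * (\<tau> n + h))"
      proof -
        have "{\<omega>\<in>space \<Omega>. A (\<tau> n + h) \<omega> = {a} \<and> \<tau> n < first \<omega>}
            = {\<omega>\<in>space \<Omega>. \<tau> n < first \<omega> \<and> first \<omega> \<le> \<tau> n + h}"
          using h by (auto simp: A_def)
        then show ?thesis using prob_first_Ioc[of "\<tau> n" "\<tau> n + h"] \<tau>n h by simp
      qed
      show ?thesis
        using T none one prob_first_tail[OF \<tau>n] unfolding past True
        by (auto simp: K_def algebra_simps simp flip: exp_add)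
    next
      case False
      \<comment> \<open>Once \<open>a\<close> has adopted, the future is deterministic: the joint
        event is the past itself or empty.\<close>
      then have \<xi>: "\<xi> n = {a}" using \<omega>0(2)[of n] by (auto simp: A_def split: if_splits)
      then have "A (\<tau> n + h) \<omega> = {a}" if "A (\<tau> n) \<omega> = \<xi> n" for \<omega>
        using that h by (auto simp: A_def split: if_splits)
      then have "{\<omega>\<in>space \<Omega>. A (\<tau> n + h) \<omega> = T \<and> (\<forall>i\<le>n. A (\<tau> i) \<omega> = \<xi> i)} =
          (if T = {a} then {\<omega>\<in>space \<Omega>. \<forall>i\<le>n. A (\<tau> i) \<omega> = \<xi> i} else {})"
        by auto
      then show ?thesis using \<xi> by (simp add: K_def)
    qed
  qed (use a first_pos in \<open>auto simp: A_def K_def prob_space_axioms split: if_splits\<close>)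
  then show ?thesis by (simp add: mem)
qed

text \<open>The delicate state is \<open>{a}\<close>: the observed past restricts the time at which
  \<open>a\<close> adopted, and this must not affect the residual waiting time of
  \<open>b\<close>.\<close>

lemma double_adoption_chain:
  assumes a: "a \<in> {1..M}" and b: "b \<in> {1..M}" and ab: "a \<noteq> b"
    and ra: "r a (config_of M {}) = 2" and rb0: "r b (config_of M {}) = 0"
    and rb: "r b (config_of M {a}) = 1"
    and r0: "\<And>j S. j \<in> {1..M} - {a, b} \<Longrightarrow> S \<subseteq> {a, b} \<Longrightarrow> r j (config_of M S) = 0"
  shows "adoption_chain M r \<Omega> (\<lambda>j t \<omega>. of_bool (j = a \<and> first \<omega> \<le> t \<or> j = b \<and> second \<omega> \<le> t))"
proof -
  define A where "A t \<omega> = (if t < first \<omega> then {} else if t < second \<omega> then {a} else {a, b})" for t \<omega>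
  \<comment> \<open>From \<open>{}\<close>, within time \<open>h\<close> neither clock rings,
    exactly one does, or both do. The last case has probability of order \<open>h\<^sup>2\<close>,
    so the direct jump to \<open>{a, b}\<close> has rate 0, as the generator demands. From
    \<open>{a}\<close>, one memoryless clock is left.\<close>
  define K :: "real \<Rightarrow> nat set \<Rightarrow> nat set \<Rightarrow> real" where
    "K h S T =
      (if S = {} then if T = {} then exp (- 2 * h) else if T = {a} then 2 * (1 - exp (- h)) * exp (- h)
          else if T = {a, b} then (1 - exp (- h))\<^sup>2 else 0
       else if S = {a} then if T = {a} then exp (- h) else if T = {a, b} then 1 - exp (- h) else 0
       else of_bool (T = S))" for h S T
  have mem: "j \<in> A t \<omega> \<longleftrightarrow> j = a \<and> first \<omega> \<le> t \<or> j = b \<and> second \<omega> \<le> t" for j t \<omega>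
    using first_le_second[of \<omega>] by (auto simp: A_def)
  have A_iff: "A t \<omega> = {} \<longleftrightarrow> t < first \<omega>" "A t \<omega> = {a} \<longleftrightarrow> first \<omega> \<le> t \<and> t < second \<omega>"
    "A t \<omega> = {a, b} \<longleftrightarrow> second \<omega> \<le> t" for t \<omega>
    using ab first_le_second[of \<omega>] by (auto simp: A_def)
  have A_cases: "A t \<omega> \<in> {{}, {a}, {a, b}}" for t \<omega>
    by (simp add: A_def)
  have ne: "{a} \<noteq> {a, b}" "{a, b} \<noteq> {a}" using ab by auto
  have "adoption_chain M r \<Omega> (\<lambda>j t \<omega>. of_bool (j \<in> A t \<omega>))"
  proof (rule adoption_chainI[where R = "{{}, {a}, {a, b}}" and K = K])
    show "{\<omega>\<in>space \<Omega>. j \<in> A t \<omega>} \<in> sets \<Omega>" for j t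
      unfolding mem by measurable
    show "A s \<omega> \<subseteq> A t \<omega>" if "s \<le> t" for s t \<omega>
      using that by (auto simp: A_def)
    show "((\<lambda>h. (K h S T - of_bool (S = T)) / h) \<longlongrightarrow>
        generator M r (config_of M S) (config_of M T)) (at_right 0)"
      if S: "S \<in> {{}, {a}, {a, b}}" and T: "T \<subseteq> {1..M}" for S T
    proof -
      consider "S = {}" | "S = {a}" | "S = {a, b}" using S by blast
      then show ?thesis
      proof cases
        case 1
        have "r j (config_of M {}) = 0" if "j \<in> {1..M}" "j \<noteq> a" for j
          using r0[of j "{}"] rb0 that by (cases "j = b") auto
        then have g: "generator M r (config_of M {}) (config_of M T)
            = 2 * (of_bool (T = {a}) - of_bool (T = {}))"
          using generator_config_of[OF _ T, of "{}" a r] a ra by simp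
        have lim: "((\<lambda>h::real. (exp (- 2 * h) - 1) / h) \<longlongrightarrow> - 2) (at_right 0)"
          "((\<lambda>h::real. 2 * (1 - exp (- h)) * exp (- h) / h) \<longlongrightarrow> 2) (at_right 0)"
          "((\<lambda>h::real. (1 - exp (- h))\<^sup>2 / h) \<longlongrightarrow> 0) (at_right 0)"
          by real_asymp+
        consider "T = {}" | "T = {a}" | "T = {a, b}" | "T \<noteq> {}" "T \<noteq> {a}" "T \<noteq> {a, b}" by blast
        then show ?thesis
          unfolding 1 g by cases (use lim ne in \<open>auto simp: K_def\<close>)
      next
        case 2
        have "r j (config_of M {a}) = 0" if "j \<in> {1..M} - {a}" "j \<noteq> b" for j
          using r0[of j "{a}"] that by auto
        then have g: "generator M r (config_of M {a}) (config_of M T)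
            = of_bool (T = {a, b}) - of_bool (T = {a})"
          using generator_config_of[OF _ T, of "{a}" b r] a b ab rb by (simp add: insert_commute)
        have lim: "((\<lambda>h::real. (exp (- h) - 1) / h) \<longlongrightarrow> - 1) (at_right 0)"
          "((\<lambda>h::real. (1 - exp (- h)) / h) \<longlongrightarrow> 1) (at_right 0)"
          by real_asymp+
        consider "T = {a}" | "T = {a, b}" | "T \<noteq> {a}" "T \<noteq> {a, b}" by blast
        then show ?thesis
          unfolding 2 g by cases (use lim ne in \<open>auto simp: K_def\<close>)
      next
        case 3
        have "generator M r (config_of M {a, b}) (config_of M T) = 0"
          by (rule generator_config_of_absorbing) (use a b T r0 in auto)
        moreover have "K h {a, b} T = of_bool ({a, b} = T)" for h
          using ne by (auto simp: K_def)
        ultimately show ?thesis by (simp only: 3 diff_self div_0 tendsto_const)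
      qed
    qed
    show "\<P>(\<omega> in \<Omega>. A (\<tau> n + h) \<omega> = T \<and> (\<forall>i\<le>n. A (\<tau> i) \<omega> = \<xi> i)) =
        \<P>(\<omega> in \<Omega>. \<forall>i\<le>n. A (\<tau> i) \<omega> = \<xi> i) * K h (\<xi> n) T"
      if \<tau>: "\<And>i. i \<le> n \<Longrightarrow> 0 \<le> \<tau> i \<and> \<tau> i \<le> \<tau> n" and T: "T \<in> {{}, {a}, {a, b}}" and h: "0 < h"
        and \<omega>0: "\<omega>0 \<in> space \<Omega>" "\<And>i. i \<le> n \<Longrightarrow> A (\<tau> i) \<omega>0 = \<xi> i" for n :: nat and \<tau> \<xi> T h \<omega>0
    proof -
      have \<tau>n: "0 \<le> \<tau> n" using \<tau> by simp
      have exp_h: "exp (- (\<tau> n + h)) = exp (- \<tau> n) * exp (- h)"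
        "exp (- 2 * (\<tau> n + h)) = exp (- 2 * \<tau> n) * exp (- 2 * h)"
        "exp (- 2 * \<tau> n) = exp (- \<tau> n) * exp (- \<tau> n)"
        by (simp_all add: algebra_simps flip: exp_add)
      consider "\<xi> n = {}" | "\<xi> n = {a}" | "\<xi> n = {a, b}"
        using A_cases[of "\<tau> n" \<omega>0] \<omega>0(2)[of n] by auto
      then show ?thesis
      proof cases
        case 1
        have \<xi>: "\<xi> i = {}" if "i \<le> n" for i
          using \<omega>0(2)[OF that] \<omega>0(2)[of n] 1 \<tau>[OF that] A_iff(1) by (metis order_le_less_trans order_refl)
        have past: "(\<forall>i\<le>n. A (\<tau> i) \<omega> = \<xi> i) \<longleftrightarrow> \<tau> n < first \<omega>" for \<omega>
          using \<xi> \<tau> by (force simp: A_iff)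
        consider "T = {}" | "T = {a}" | "T = {a, b}" using T by blast
        then show ?thesis
        proof cases
          case T: 1
          have "{\<omega>\<in>space \<Omega>. A (\<tau> n + h) \<omega> = T \<and> \<tau> n < first \<omega>} = {\<omega>\<in>space \<Omega>. \<tau> n + h < first \<omega>}"
            using h by (auto simp: A_iff T)
          then show ?thesis
            using prob_first_tail[OF \<tau>n] prob_first_tail[of "\<tau> n + h"] \<tau>n h exp_h(2)
            unfolding past 1 by (simp add: K_def T)
        next
          case T: 2
          \<comment> \<open>Exactly one clock rings in the window: \<open>prob_first_second\<close>
            applies with the window as \<open>I\<close> and its right end as the level.\<close>
          have "{\<omega>\<in>space \<Omega>. A (\<tau> n + h) \<omega> = T \<and> \<tau> n < first \<omega>}
              = {\<omega>\<in>space \<Omega>. first \<omega> \<in> {\<tau> n<..\<tau> n + h} \<and> \<tau> n + h < second \<omega>}"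
            using h by (auto simp: A_iff T)
          also have "prob \<dots> = (\<P>(\<omega> in \<Omega>. U \<omega> \<in> {\<tau> n<..\<tau> n + h}) + \<P>(\<omega> in \<Omega>. V \<omega> \<in> {\<tau> n<..\<tau> n + h}))
              * exp (- (\<tau> n + h))"
            by (rule prob_first_second) (use \<tau>n h in auto)
          also have "\<dots> = 2 * (exp (- \<tau> n) - exp (- (\<tau> n + h))) * exp (- (\<tau> n + h))"
            using prob_clock_Ioc[of "\<tau> n" "\<tau> n + h"] \<tau>n h by simp
          also have "\<dots> = exp (- 2 * \<tau> n) * (2 * (1 - exp (- h)) * exp (- h))"
            unfolding exp_h by (simp add: algebra_simps)
          finally show ?thesis
            using prob_first_tail[OF \<tau>n] unfolding past 1 by (simp add: K_def T)
        next
          case T: 3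
          have "{\<omega>\<in>space \<Omega>. A (\<tau> n + h) \<omega> = T \<and> \<tau> n < first \<omega>}
              = {\<omega>\<in>space \<Omega>. \<tau> n < first \<omega> \<and> second \<omega> \<le> \<tau> n + h}"
            using h by (auto simp: A_iff T)
          also have "prob \<dots> = exp (- 2 * \<tau> n) * (1 - exp (- h))\<^sup>2"
            using prob_both_Ioc[of "\<tau> n" "\<tau> n + h"] \<tau>n h exp_h(1,3)
            by (simp add: algebra_simps power2_eq_square)
          finally show ?thesis
            using prob_first_tail[OF \<tau>n] ne unfolding past 1 by (simp add: K_def T)
        qed
      next
        case 2
        \<comment> \<open>the first adoption times compatible with the prescribed past\<close>
        define I where "I = {s. \<forall>i\<le>n. \<tau> i < s \<longleftrightarrow> \<xi> i = {}}"
        have "I \<in> sets borel" unfolding I_def by measurable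
        \<comment> \<open>The index \<open>n\<close> itself gives the bound, because
          \<open>\<xi> n\<close> is nonempty.\<close>
        moreover have "I \<subseteq> {..\<tau> n}"
          using 2 by (force simp: I_def)
        ultimately have I: "I \<in> sets borel" "I \<subseteq> {..\<tau> n}" "I \<subseteq> {..\<tau> n + h}" using h by auto
        have \<xi>: "\<xi> i = {} \<or> \<xi> i = {a}" if "i \<le> n" for i
        proof -
          have "\<tau> i < second \<omega>0"
            using \<omega>0(2)[of n] 2 \<tau>[OF that] by (simp add: A_iff)
          then have "A (\<tau> i) \<omega>0 = {} \<or> A (\<tau> i) \<omega>0 = {a}" by (simp add: A_def)
          then show ?thesis unfolding \<omega>0(2)[OF that] .
        qed
        \<comment> \<open>The past splits into a condition on \<open>first\<close> alone and the
          survival of the later clock. The probabilities of \<open>I\<close> under \<open>U\<close>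
          and \<open>V\<close> are never computed: their sum is a common factor of both sides of the
          Markov identity.\<close>
        have past: "(\<forall>i\<le>n. A (\<tau> i) \<omega> = \<xi> i) \<longleftrightarrow> first \<omega> \<in> I \<and> \<tau> n < second \<omega>" for \<omega>
        proof
          assume *: "\<forall>i\<le>n. A (\<tau> i) \<omega> = \<xi> i"
          then have "\<tau> n < second \<omega>" using 2 A_iff(2)[of "\<tau> n" \<omega>] by simp
          moreover have "\<tau> i < first \<omega> \<longleftrightarrow> \<xi> i = {}" if "i \<le> n" for i
            using * that by (simp flip: A_iff(1))
          ultimately show "first \<omega> \<in> I \<and> \<tau> n < second \<omega>" by (simp add: I_def)
        next
          assume *: "first \<omega> \<in> I \<and> \<tau> n < second \<omega>"
          show "\<forall>i\<le>n. A (\<tau> i) \<omega> = \<xi> i"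
          proof (intro allI impI)
            fix i assume i: "i \<le> n"
            then have "\<tau> i < first \<omega> \<longleftrightarrow> \<xi> i = {}" "\<tau> i < second \<omega>"
              using * \<tau>[OF i] by (auto simp: I_def)
            then show "A (\<tau> i) \<omega> = \<xi> i" using \<xi>[OF i] unfolding A_def by metis
          qed
        qed
        consider "T = {}" | "T = {a}" | "T = {a, b}" using T by blast
        then show ?thesis
        proof cases
          case T: 1
          have empty: "{\<omega>\<in>space \<Omega>. A (\<tau> n + h) \<omega> = T \<and> first \<omega> \<in> I \<and> \<tau> n < second \<omega>} = {}"
            using I h by (auto simp: A_iff T)
          show ?thesis unfolding past 2 empty by (simp add: K_def T)
        next
          case T: 2
          have "{\<omega>\<in>space \<Omega>. A (\<tau> n + h) \<omega> = T \<and> first \<omega> \<in> I \<and> \<tau> n < second \<omega>}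
              = {\<omega>\<in>space \<Omega>. first \<omega> \<in> I \<and> \<tau> n + h < second \<omega>}"
            using I h by (auto simp: A_iff T)
          then show ?thesis
            using prob_first_second[OF \<tau>n I(1,2)] prob_first_second[of "\<tau> n + h", OF _ I(1,3)]
              \<tau>n h exp_h(1)
            unfolding past 2 by (simp add: K_def T)
        next
          case T: 3
          have "{\<omega>\<in>space \<Omega>. A (\<tau> n + h) \<omega> = T \<and> first \<omega> \<in> I \<and> \<tau> n < second \<omega>}
              = {\<omega>\<in>space \<Omega>. first \<omega> \<in> I \<and> \<tau> n < second \<omega> \<and> second \<omega> \<le> \<tau> n + h}"
            by (auto simp: A_iff T)
          then show ?thesis
            using prob_first_second[OF \<tau>n I(1,2)]
              prob_first_second_Ioc[of "\<tau> n" "\<tau> n + h", OF _ _ I(1,2)] \<tau>n h exp_h(1) ne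
            unfolding past 2 by (simp add: K_def T algebra_simps)
        qed
      next
        case 3
        have "A (\<tau> n + h) \<omega> = {a, b}" if "A (\<tau> n) \<omega> = \<xi> n" for \<omega>
          using that h by (simp add: 3 A_iff)
        then have "{\<omega>\<in>space \<Omega>. A (\<tau> n + h) \<omega> = T \<and> (\<forall>i\<le>n. A (\<tau> i) \<omega> = \<xi> i)} =
            (if T = {a, b} then {\<omega>\<in>space \<Omega>. \<forall>i\<le>n. A (\<tau> i) \<omega> = \<xi> i} else {})"
          by auto
        then show ?thesis using ne by (simp add: 3 K_def)
      qed
    qed
  qed (use a b ne A_cases first_pos in \<open>auto simp: A_iff K_def prob_space_axioms\<close>)
  then show ?thesis by (simp add: mem)
qed

section \<open>Expected fractions of adopters\<close>

lemma adopter_fraction_single: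
  assumes "a \<in> {1..M}"
  shows "adopter_fraction M \<Omega> (\<lambda>j t \<omega>. of_bool (j = a \<and> first \<omega> \<le> t)) t
    = \<P>(\<omega> in \<Omega>. first \<omega> \<le> t) / real M"
proof -
  have "(\<Sum>j=1..M. of_bool (j = a \<and> first \<omega> \<le> t) :: real) = indicator {\<omega>. first \<omega> \<le> t} \<omega>" for \<omega>
    using assms by (simp add: of_bool_conj indicator_def sum.delta flip: sum_distrib_right)
  then show ?thesis
    by (simp add: adopter_fraction_def Int_def conj_commute)
qed

lemma adopter_fraction_double:
  assumes "a \<in> {1..M}" "b \<in> {1..M}" "a \<noteq> b"
  shows "adopter_fraction M \<Omega> (\<lambda>j t \<omega>. of_bool (j = a \<and> first \<omega> \<le> t \<or> j = b \<and> second \<omega> \<le> t)) t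
    = (\<P>(\<omega> in \<Omega>. first \<omega> \<le> t) + \<P>(\<omega> in \<Omega>. second \<omega> \<le> t)) / real M"
proof -
  have eq: "(\<Sum>j=1..M. of_bool (j = a \<and> first \<omega> \<le> t \<or> j = b \<and> second \<omega> \<le> t) :: real)
      = indicator {\<omega>\<in>space \<Omega>. first \<omega> \<le> t} \<omega> + indicator {\<omega>\<in>space \<Omega>. second \<omega> \<le> t} \<omega>"
    if "\<omega> \<in> space \<Omega>" for \<omega>
  proof -
    have "(\<Sum>j=1..M. of_bool (j = a \<and> first \<omega> \<le> t \<or> j = b \<and> second \<omega> \<le> t) :: real)
      = (\<Sum>j=1..M. (if j = a then of_bool (first \<omega> \<le> t) else 0) + (if j = b then of_bool (second \<omega> \<le> t) else 0))"
      by (rule sum.cong) (use assms in auto)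
    then show ?thesis
      using assms that by (simp add: sum.distrib indicator_def)
  qed
  have "expectation (\<lambda>\<omega>. \<Sum>j=1..M. of_bool (j = a \<and> first \<omega> \<le> t \<or> j = b \<and> second \<omega> \<le> t) :: real)
      = expectation (\<lambda>\<omega>. indicator {\<omega>\<in>space \<Omega>. first \<omega> \<le> t} \<omega> + indicator {\<omega>\<in>space \<Omega>. second \<omega> \<le> t} \<omega>)"
    by (intro Bochner_Integration.integral_cong refl eq)
  also have "\<dots> = \<P>(\<omega> in \<Omega>. first \<omega> \<le> t) + \<P>(\<omega> in \<Omega>. second \<omega> \<le> t)"
    by (subst Bochner_Integration.integral_add)
      (auto simp: Int_def conj_commute emeasure_eq_measure intro!: integrable_real_indicator)
  finally show ?thesis
    by (simp add: adopter_fraction_def)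
qed

text \<open>The clocks are positive everywhere, so \<open>s = 0\<close> in
  \<open>prob_both_Ioc\<close> gives the value \<open>(1 - exp (- t))\<^sup>2\<close>.\<close>

lemma prob_second_pos: "0 < t \<Longrightarrow> 0 < \<P>(\<omega> in \<Omega>. second \<omega> \<le> t)"
  using prob_both_Ioc[of 0 t] by (simp add: first_pos)

lemma adopter_fraction_single_less_double:
  assumes "a \<in> {1..M}" "b \<in> {1..M}" "a \<noteq> b" "0 < t"
  shows "adopter_fraction M \<Omega> (\<lambda>j t \<omega>. of_bool (j = a \<and> first \<omega> \<le> t)) t
    < adopter_fraction M \<Omega> (\<lambda>j t \<omega>. of_bool (j = a \<and> first \<omega> \<le> t \<or> j = b \<and> second \<omega> \<le> t)) t"
  using assms prob_second_pos[of t]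
  unfolding adopter_fraction_single[OF assms(1)] adopter_fraction_double[OF assms(1-3)]
  by (simp add: divide_strict_right_mono)

end

section \<open>Construction of the clocks\<close>

text \<open>An infinite product of exponential laws lives on real sequences, the sample space fixed
  in \<open>matched_circles\<close>; coordinates 0 and 1, made positive, serve as clocks.\<close>

lemma two_clocks_exist: "\<exists>(\<Omega> :: (nat \<Rightarrow> real) measure) U V. two_clocks \<Omega> U V"
proof -
  define E where "E = density lborel (exponential_density 1)"
  define \<Omega> where "\<Omega> = Pi\<^sub>M (UNIV :: nat set) (\<lambda>_. E)"
  \<comment> \<open>the chain starts at 0 for every sample point, so the clocks must be positive everywhere,
    not just almost everywhere\<close>
  define g :: "real \<Rightarrow> real" where "g x = (if 0 < x then x else 1)" for x
  have E: "prob_space E" unfolding E_def by (rule prob_space_exponential_density) simp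
  have sE [simp, measurable_cong]: "sets E = sets borel" by (simp add: E_def)
  have g [measurable]: "g \<in> borel_measurable borel" unfolding g_def by measurable
  interpret E: prob_space E by (rule E)
  interpret \<Omega>: prob_space \<Omega> unfolding \<Omega>_def by (intro prob_space_PiM E)
  interpret P: product_prob_space "\<lambda>_. E" "UNIV :: nat set" ..
  have [simp]: "space E = UNIV" by (simp add: E_def)
  have coord: "(\<lambda>\<omega>. g (\<omega> i)) \<in> borel_measurable \<Omega>" for i
    unfolding \<Omega>_def by measurable
  \<comment> \<open>This cylinder formula yields both the marginals (one index) and independence
    (two indices).\<close>
  have box: "measure \<Omega> {\<omega>\<in>space \<Omega>. \<forall>i\<in>J. g (\<omega> i) \<in> A i} = (\<Prod>i\<in>J. measure E (g -` A i))"
    if J: "finite J" and A: "\<And>i. i \<in> J \<Longrightarrow> A i \<in> sets borel" for J A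
  proof -
    have "{\<omega>\<in>space \<Omega>. \<forall>i\<in>J. g (\<omega> i) \<in> A i} = {\<omega>\<in>space \<Omega>. \<forall>i\<in>J. \<omega> i \<in> g -` A i}"
      by auto
    then show ?thesis
      using P.emeasure_PiM_Collect[of J "\<lambda>i. g -` A i"] J A measurable_sets[OF g]
      by (simp add: \<Omega>_def P.emeasure_eq_measure E.emeasure_eq_measure prod_ennreal prod_nonneg)
  qed
  have tail: "measure E (g -` {t<..}) = exp (- t)" if t: "0 \<le> t" for t
  proof -
    have D: "distributed E lborel (\<lambda>x. x) (exponential_density 1)"
      unfolding distributed_def E_def
      by (auto simp: distr_id2 exponential_density_nonneg intro!: measure_eqI)
    have "measure E {0<..} = 1"
      using E.exponential_distributedD_gt[OF D, of 0] by (simp add: greaterThan_def)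
    \<comment> \<open>The exponential law charges only positive reals, where \<open>g\<close> is the
      identity, so \<open>g\<close> leaves the tail probabilities unchanged.\<close>
    then have "AE x in E. x \<in> {0<..}"
      by (subst E.AE_in_set_eq_1) auto
    then have "AE x in E. x \<in> g -` {t<..} \<longleftrightarrow> x \<in> {t<..}"
      by eventually_elim (simp add: g_def)
    then have "measure E (g -` {t<..}) = measure E {t<..}"
      using measurable_sets[OF g, of "{t<..}"] by (intro measure_eq_AE) auto
    also have "\<dots> = exp (- t)"
      using E.exponential_distributedD_gt[OF D t] by (simp add: greaterThan_def)
    finally show ?thesis .
  qed
  have one: "measure \<Omega> {\<omega>\<in>space \<Omega>. g (\<omega> i) \<in> A} = measure E (g -` A)" if "A \<in> sets borel" for i A
    using box[of "{i}" "\<lambda>_. A"] that by simp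
  have "two_clocks \<Omega> (\<lambda>\<omega>. g (\<omega> 0)) (\<lambda>\<omega>. g (\<omega> 1))"
  proof
    show "0 < g (\<omega> 0)" "0 < g (\<omega> 1)" for \<omega> :: "nat \<Rightarrow> real"
      by (auto simp: g_def)
    show "measure \<Omega> {\<omega>\<in>space \<Omega>. g (\<omega> 0) \<in> I \<and> g (\<omega> 1) \<in> J} =
        measure \<Omega> {\<omega>\<in>space \<Omega>. g (\<omega> 0) \<in> I} * measure \<Omega> {\<omega>\<in>space \<Omega>. g (\<omega> 1) \<in> J}"
      if "I \<in> sets borel" "J \<in> sets borel" for I J
      using box[of "{0, 1}" "\<lambda>i. if i = 0 then I else J"] that by (simp add: one)
    show "measure \<Omega> {\<omega>\<in>space \<Omega>. g (\<omega> 0) \<in> {t<..}} = exp (- t)"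
      "measure \<Omega> {\<omega>\<in>space \<Omega>. g (\<omega> 1) \<in> {t<..}} = exp (- t)" if "0 \<le> t" for t
      using that by (simp_all only: one[OF borel_open[OF open_greaterThan]] tail)
  qed (use coord in auto)
  then show ?thesis by blast
qed

section \<open>The two pairs of circles\<close>

theorem lemma13:
  fixes M :: nat
  assumes "M \<ge> 3"
  shows "(\<exists>p q1 q2 \<Omega>1 X1 \<Omega>2 X2. matched_circles M p q1 q2 \<Omega>1 X1 \<Omega>2 X2 \<and>
            (\<forall>t>0. adopter_fraction M \<Omega>1 X1 t > adopter_fraction M \<Omega>2 X2 t)) \<and>
         (\<exists>p q1 q2 \<Omega>1 X1 \<Omega>2 X2. matched_circles M p q1 q2 \<Omega>1 X1 \<Omega>2 X2 \<and>
            (\<forall>t>0. adopter_fraction M \<Omega>1 X1 t < adopter_fraction M \<Omega>2 X2 t))"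
proof -
  obtain \<Omega> :: "(nat \<Rightarrow> real) measure" and U V where "two_clocks \<Omega> U V"
    using two_clocks_exist by blast
  then interpret two_clocks \<Omega> U V .
  define single where "single a j t \<omega> = (of_bool (j = a \<and> first \<omega> \<le> t) :: real)"
    for a j :: nat and t :: real and \<omega>
  define double where "double a b j t \<omega> =
      (of_bool (j = a \<and> first \<omega> \<le> t \<or> j = b \<and> second \<omega> \<le> t) :: real)"
    for a b j :: nat and t :: real and \<omega>
  have less: "adopter_fraction M \<Omega> (single a) t < adopter_fraction M \<Omega> (double a b) t"
    if "a \<in> {1..M}" "b \<in> {1..M}" "a \<noteq> b" "0 < t" for a b t
    using adopter_fraction_single_less_double[OF that]
    by (simp add: single_def[abs_def] double_def[abs_def])
  have nodes: "(1::nat) \<in> {1..M}" "2 \<in> {1..M}" "3 \<in> {1..M}" "M \<in> {1..M}"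
    using assms by auto
  have one_neq_two: "(1::nat) \<noteq> 2" by simp
  \<comment> \<open>Here \<open>M \<ge> 3\<close> separates the two neighbours of node 2 (1 and 3)
    and those of node 1 (\<open>M\<close> and 2). With two nodes they would coincide, and an
    influence could not be moved to the other side.\<close>
  have special: "pred_node M 1 = M" "pred_node M 2 = 1" "succ_node M 1 = 2" "succ_node M 2 = 3"
    using assms by (auto simp: pred_node_def succ_node_def)
  show ?thesis
  proof (rule conjI)
    \<comment> \<open>Node 1 starts and node 2 comes after it, so the one-sided influence passes
      from 1 to 2. In the two-sided circle it is assigned to node 3, which never adopts.\<close>
    define p :: "nat \<Rightarrow> real" where "p j = 2 * of_bool (j = 1)" for j
    define q1 :: "nat \<Rightarrow> real" where "q1 j = of_bool (j = 2)" for j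
    define q2 :: "nat \<Rightarrow> nat \<Rightarrow> real" where "q2 i j = of_bool (i = 3 \<and> j = 2)" for i j
    have "adoption_chain M (\<lambda>j x. p j + q1 j * x (pred_node M j)) \<Omega> (double 1 2)"
      unfolding double_def
      by (rule double_adoption_chain) (use nodes special in \<open>auto simp: p_def q1_def\<close>)
    moreover have "adoption_chain M (\<lambda>j x. p j + q2 (pred_node M j) j * x (pred_node M j)
        + q2 (succ_node M j) j * x (succ_node M j)) \<Omega> (single 1)"
      unfolding single_def
      by (rule single_adoption_chain) (use nodes special in \<open>auto simp: p_def q2_def\<close>)
    ultimately have "matched_circles M p q1 q2 \<Omega> (double 1 2) \<Omega> (single 1)"
      unfolding matched_circles_def one_sided_circle_def two_sided_circle_def
      using special by (auto simp: p_def q1_def q2_def)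
    then show "\<exists>p q1 q2 \<Omega>1 X1 \<Omega>2 X2. matched_circles M p q1 q2 \<Omega>1 X1 \<Omega>2 X2 \<and>
        (\<forall>t>0. adopter_fraction M \<Omega>1 X1 t > adopter_fraction M \<Omega>2 X2 t)"
      using less[OF nodes(1,2) one_neq_two] by blast
  next
    \<comment> \<open>Now node 2 starts and node 1 comes before it: the one-sided influence on 1
      comes from \<open>M\<close>, which never adopts, while the two-sided one comes from 2.\<close>
    define p :: "nat \<Rightarrow> real" where "p j = 2 * of_bool (j = 2)" for j
    define q1 :: "nat \<Rightarrow> real" where "q1 j = of_bool (j = 1)" for j
    define q2 :: "nat \<Rightarrow> nat \<Rightarrow> real" where "q2 i j = of_bool (i = 2 \<and> j = 1)" for i j
    have "adoption_chain M (\<lambda>j x. p j + q1 j * x (pred_node M j)) \<Omega> (single 2)"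
      unfolding single_def
      by (rule single_adoption_chain) (use nodes special assms in \<open>auto simp: p_def q1_def\<close>)
    moreover have "adoption_chain M (\<lambda>j x. p j + q2 (pred_node M j) j * x (pred_node M j)
        + q2 (succ_node M j) j * x (succ_node M j)) \<Omega> (double 2 1)"
      unfolding double_def
      by (rule double_adoption_chain) (use nodes special assms in \<open>auto simp: p_def q2_def\<close>)
    ultimately have "matched_circles M p q1 q2 \<Omega> (single 2) \<Omega> (double 2 1)"
      unfolding matched_circles_def one_sided_circle_def two_sided_circle_def
      using special assms by (auto simp: p_def q1_def q2_def)
    then show "\<exists>p q1 q2 \<Omega>1 X1 \<Omega>2 X2. matched_circles M p q1 q2 \<Omega>1 X1 \<Omega>2 X2 \<and>
        (\<forall>t>0. adopter_fraction M \<Omega>1 X1 t < adopter_fraction M \<Omega>2 X2 t)"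
      using less[OF nodes(2,1) one_neq_two[symmetric]] by blast
  qed
qed

end
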